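(* Let $G$ be a finite graph such that $\max(\alpha_M(G),\omega_M(G))=2^k$ for some integer $k\geq 1$. Then $p(G)=k+1$ if and only if $\iota(G)=2^k$ or $\iota(\overline{G})=2^k$.
   Context: Graphs are finite, simple and undirected; $\overline{G}$ denotes the complement of $G$, and $\iota(G)$ denotes the number of isolated vertices of $G$. For $W\subseteq V(G)$, $G[W]$ is the induced subgraph. A subset $M\subseteq V(G)$ is a module of $G$ if every $v\in V(G)\setminus M$ is adjacent either to all vertices of $M$ or to none of them; the modules $\emptyset$, $V(G)$ and the singletons are trivial. A graph $G$ is prime if $|V(G)|\geq 4$ and all its modules are trivial. An extension of $G$ is a graph $H$ with $V(H)\supseteq V(G)$ and $H[V(G)]=G$; a $p$-extension is an extension with $|V(H)\setminus V(G)|=p$. The prime bound $p(G)$ is the smallest integer $p\ge 0$ such that $G$ admits a prime $p$-extension (such extensions exist whenever $|V(G)|\ge 2$). The modular clique number $\omega_M(G)$ is the largest size of a module of $G$ that is a clique in $G$; the modular stability number $\alpha_M(G)$ is the largest size of a module of $G$ that is a stable set in $G$. *)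

theory Defs
  imports "Graph_Theory.Graph_Theory" "HOL-Library.Infinite_Typeclass"
begin

text \<open>
  A finite simple undirected graph is a \<^locale>\<open>pair_graph\<close>: finitely many vertices and a symmetric,
  irreflexive set of ordered pairs on them, each edge being present in both orientations.
\<close>

definition complement :: "'a pair_pre_digraph \<Rightarrow> 'a pair_pre_digraph" where
  "complement G = \<lparr> pverts = pverts G,
     parcs = {(u, v). u \<in> pverts G \<and> v \<in> pverts G \<and> u \<noteq> v \<and> (u, v) \<notin> parcs G} \<rparr>"

definition num_isolated :: "'a pair_pre_digraph \<Rightarrow> nat" where
  "num_isolated G = card {v \<in> pverts G. \<forall>u \<in> pverts G. (v, u) \<notin> parcs G}"

definition is_module :: "'a pair_pre_digraph \<Rightarrow> 'a set \<Rightarrow> bool" where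
  "is_module G M \<longleftrightarrow> M \<subseteq> pverts G \<and>
     (\<forall>v \<in> pverts G - M. (\<forall>m \<in> M. (v, m) \<in> parcs G) \<or> (\<forall>m \<in> M. (v, m) \<notin> parcs G))"

definition trivial_module :: "'a pair_pre_digraph \<Rightarrow> 'a set \<Rightarrow> bool" where
  "trivial_module G M \<longleftrightarrow> M = {} \<or> M = pverts G \<or> (\<exists>v \<in> pverts G. M = {v})"

definition prime_graph :: "'a pair_pre_digraph \<Rightarrow> bool" where
  "prime_graph G \<longleftrightarrow> card (pverts G) \<ge> 4 \<and> (\<forall>M. is_module G M \<longrightarrow> trivial_module G M)"

definition is_clique :: "'a pair_pre_digraph \<Rightarrow> 'a set \<Rightarrow> bool" where
  "is_clique G C \<longleftrightarrow> C \<subseteq> pverts G \<and> (\<forall>u \<in> C. \<forall>v \<in> C. u \<noteq> v \<longrightarrow> (u, v) \<in> parcs G)"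

definition is_stable :: "'a pair_pre_digraph \<Rightarrow> 'a set \<Rightarrow> bool" where
  "is_stable G S \<longleftrightarrow> S \<subseteq> pverts G \<and> (\<forall>u \<in> S. \<forall>v \<in> S. (u, v) \<notin> parcs G)"

definition modular_clique_number :: "'a pair_pre_digraph \<Rightarrow> nat" where
  "modular_clique_number G = Max (card ` {M. is_module G M \<and> is_clique G M})"

definition modular_stability_number :: "'a pair_pre_digraph \<Rightarrow> nat" where
  "modular_stability_number G = Max (card ` {M. is_module G M \<and> is_stable G M})"

definition is_extension :: "'a pair_pre_digraph \<Rightarrow> 'a pair_pre_digraph \<Rightarrow> bool" where
  "is_extension G H \<longleftrightarrow> pair_graph H \<and> pverts G \<subseteq> pverts H \<and>
     with_proj H \<restriction> pverts G = with_proj G"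

definition is_p_extension :: "nat \<Rightarrow> 'a pair_pre_digraph \<Rightarrow> 'a pair_pre_digraph \<Rightarrow> bool" where
  "is_p_extension p G H \<longleftrightarrow> is_extension G H \<and> card (pverts H - pverts G) = p"

text \<open>
  The vertices added by an extension come from the vertex type itself, so that type is required to
  be infinite; it then provides arbitrarily many fresh vertices for every finite graph.
\<close>

definition prime_bound :: "'a::infinite pair_pre_digraph \<Rightarrow> nat" where
  "prime_bound G = (LEAST p. \<exists>H. is_p_extension p G H \<and> prime_graph H)"

end

theory Submission
  imports Defs
begin

text \<open>
  Two vertices are twins if they form a module; the twin classes are exactly the maximal clique and
  stable modules. If \<open>\<iota>(G) = 2\<^sup>k\<close>, primality forces the isolated vertices to have distinct nonempty
  traces on the new vertices, so more than \<open>k\<close> new vertices are needed. Conversely, let all twin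
  classes have at most \<open>2\<^sup>k\<close> elements and let \<open>G\<close> and its complement have fewer than \<open>2\<^sup>k\<close> isolated
  vertices. A new vertex adjacent to half of each twin class halves both bounds, which reduces the
  construction of a prime extension by \<open>k\<close> vertices to \<open>k = 1\<close>. In that case the minimal modules with
  at least two elements are pairwise disjoint, and a new vertex with neighbourhood \<open>A\<close> works if \<open>A\<close>
  splits all of them and no proper nonempty module sees its outside exactly as the new vertex does.
\<close>

section \<open>Elementary facts about finite simple graphs\<close>

lemma pair_graph_iff:
  "pair_graph G \<longleftrightarrow> finite (pverts G) \<and> parcs G \<subseteq> pverts G \<times> pverts G \<and>
     sym (parcs G) \<and> irrefl (parcs G)" (is "?L \<longleftrightarrow> ?R")
proof
  assume ?L
  then interpret pair_graph G .
  show ?R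
    using pair_finite_verts arc_fst_in_verts arc_snd_in_verts pair_sym_arcs pair_no_loops
    by (fastforce simp: symmetric_def irrefl_def)
next
  assume R: ?R
  show ?L
  proof
    show "finite (parcs G)"
      using R by (meson finite_SigmaI finite_subset)
    show "symmetric (with_proj G)"
      using R by (simp add: symmetric_def)
  qed (use R in \<open>auto simp: irrefl_def\<close>)
qed

lemma pair_graph_sym: "pair_graph G \<Longrightarrow> (u, v) \<in> parcs G \<longleftrightarrow> (v, u) \<in> parcs G"
  by (meson pair_graph_iff symD)

lemma pair_graph_irrefl: "pair_graph G \<Longrightarrow> (u, u) \<notin> parcs G"
  by (auto simp: pair_graph_iff irrefl_def)

lemma pair_graph_finite: "pair_graph G \<Longrightarrow> finite (pverts G)"
  by (simp add: pair_graph_iff)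

lemma pair_graph_arc_in_verts:
  "pair_graph G \<Longrightarrow> (u, v) \<in> parcs G \<Longrightarrow> u \<in> pverts G \<and> v \<in> pverts G"
  by (auto simp: pair_graph_iff)


subsection \<open>Modules and twins\<close>

lemma is_module_iff:
  "is_module G M \<longleftrightarrow> M \<subseteq> pverts G \<and>
     (\<forall>v \<in> pverts G - M. \<forall>m \<in> M. \<forall>n \<in> M. (v, m) \<in> parcs G \<longrightarrow> (v, n) \<in> parcs G)"
  unfolding is_module_def by blast

lemma is_module_subset: "is_module G M \<Longrightarrow> M \<subseteq> pverts G"
  by (simp add: is_module_def)

lemma is_moduleD:
  "is_module G M \<Longrightarrow> v \<in> pverts G \<Longrightarrow> v \<notin> M \<Longrightarrow> m \<in> M \<Longrightarrow> n \<in> M \<Longrightarrow>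
     (v, m) \<in> parcs G \<longleftrightarrow> (v, n) \<in> parcs G"
  unfolding is_module_iff by blast

lemma is_moduleI:
  assumes "M \<subseteq> pverts G"
    and "\<And>v m. v \<in> pverts G \<Longrightarrow> v \<notin> M \<Longrightarrow> m \<in> M \<Longrightarrow> (v, m) \<in> parcs G \<longleftrightarrow> P v"
  shows "is_module G M"
  using assms unfolding is_module_def by (metis DiffE)

lemma is_module_finite: "pair_graph G \<Longrightarrow> is_module G M \<Longrightarrow> finite M"
  by (rule finite_subset[OF is_module_subset pair_graph_finite])

lemma is_module_Int: "is_module G M \<Longrightarrow> is_module G N \<Longrightarrow> is_module G (M \<inter> N)"
  unfolding is_module_iff by blast

lemma is_module_Un:
  assumes "is_module G M" "is_module G N" "M \<inter> N \<noteq> {}"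
  shows "is_module G (M \<union> N)"
proof -
  obtain x where x: "x \<in> M" "x \<in> N"
    using assms by blast
  show ?thesis
  proof (rule is_moduleI)
    show "(v, m) \<in> parcs G \<longleftrightarrow> (v, x) \<in> parcs G"
      if "v \<in> pverts G" "v \<notin> M \<union> N" "m \<in> M \<union> N" for v m
      using that x is_moduleD[OF assms(1), of v m x] is_moduleD[OF assms(2), of v m x] by blast
  qed (use assms(1,2) is_module_subset in blast)
qed

text \<open>The critical outside vertices \<open>v\<close> lie in \<open>M \<inter> N\<close>.
  Compare \<open>v\<close> with a vertex \<open>w\<close> of \<open>N\<close> outside
  \<open>M\<close>: each vertex of \<open>M - N\<close> lies outside \<open>N\<close> and treats
  \<open>v\<close> and \<open>w\<close> alike, while \<open>w\<close> treats all of \<open>M\<close>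
  alike.\<close>

lemma is_module_Diff:
  assumes G: "pair_graph G" and M: "is_module G M" and N: "is_module G N" and "\<not> N \<subseteq> M"
  shows "is_module G (M - N)"
proof -
  obtain w where w: "w \<in> N" "w \<notin> M" "w \<in> pverts G"
    using assms(4) is_module_subset[OF N] by blast
  have "(v, m) \<in> parcs G \<longleftrightarrow> (v, n) \<in> parcs G"
    if v: "v \<in> pverts G - (M - N)" and m: "m \<in> M - N" "n \<in> M - N" for v m n
  proof (cases "v \<in> M")
    case False
    then show ?thesis
      using is_moduleD[OF M, of v m n] v m by blast
  next
    case True
    have "(v, z) \<in> parcs G \<longleftrightarrow> (w, z) \<in> parcs G" if "z \<in> M - N" for z
      using is_moduleD[OF N, of z v w] that True v w is_module_subset[OF M] pair_graph_sym[OF G]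
      by blast
    then show ?thesis
      using m is_moduleD[OF M, of w m n] w by blast
  qed
  then show ?thesis
    using is_module_subset[OF M] unfolding is_module_iff by blast
qed

lemma is_module_singleton: "v \<in> pverts G \<Longrightarrow> is_module G {v}"
  by (simp add: is_module_iff)

lemma is_module_pverts: "is_module G (pverts G)"
  by (simp add: is_module_iff)

text \<open>The case \<open>u = v\<close> is included, which makes this an equivalence relation on
  the vertex set.\<close>

definition twin :: "'a pair_pre_digraph \<Rightarrow> 'a \<Rightarrow> 'a \<Rightarrow> bool" where
  "twin G u v \<longleftrightarrow> is_module G {u, v}"

lemma twin_sym: "twin G u v \<longleftrightarrow> twin G v u"
  by (simp add: twin_def insert_commute)

lemma twin_in_verts: "twin G u v \<Longrightarrow> u \<in> pverts G \<and> v \<in> pverts G"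
  by (auto simp: twin_def is_module_def)

lemma twin_refl: "u \<in> pverts G \<Longrightarrow> twin G u u"
  by (simp add: twin_def is_module_singleton)

lemma twinD:
  "twin G u v \<Longrightarrow> z \<in> pverts G \<Longrightarrow> z \<noteq> u \<Longrightarrow> z \<noteq> v \<Longrightarrow> (z, u) \<in> parcs G \<longleftrightarrow> (z, v) \<in> parcs G"
  unfolding twin_def by (erule is_moduleD) auto

text \<open>\<open>w\<close> sees \<open>u\<close> and \<open>v\<close> alike, and \<open>u\<close>
  sees \<open>v\<close> and \<open>w\<close> alike, so all three pairs have the same
  adjacency.\<close>

lemma twin_triangle:
  assumes G: "pair_graph G" and "twin G u v" "twin G v w" "u \<noteq> v" "v \<noteq> w" "u \<noteq> w"
  shows "(u, v) \<in> parcs G \<longleftrightarrow> (v, w) \<in> parcs G"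
  using twinD[OF assms(2), of w] twinD[OF assms(3), of u] assms(4-6) pair_graph_sym[OF G]
    twin_in_verts[OF assms(2)] twin_in_verts[OF assms(3)]
  by metis

text \<open>A vertex \<open>z\<close> other than \<open>v\<close> compares \<open>u\<close> with
  \<open>w\<close> through \<open>v\<close>; for \<open>z = v\<close> the triangle of twins is
  needed.\<close>

lemma twin_trans:
  assumes G: "pair_graph G" and uv: "twin G u v" and vw: "twin G v w"
  shows "twin G u w"
proof (cases "u = v \<or> v = w \<or> u = w")
  case True
  then show ?thesis
    using uv vw twin_refl twin_in_verts by metis
next
  case False
  have "(z, u) \<in> parcs G \<longleftrightarrow> (z, w) \<in> parcs G" if "z \<in> pverts G" "z \<notin> {u, w}" for z
    using that twinD[OF uv, of z] twinD[OF vw, of z] twin_triangle[OF G uv vw] False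
      pair_graph_sym[OF G] by (cases "z = v") auto
  then show ?thesis
    using twin_in_verts[OF uv] twin_in_verts[OF vw] by (auto simp: twin_def is_module_iff)
qed

text \<open>For \<open>u\<close> outside the graph this is empty, so later statements can range over
  all \<open>u\<close>.\<close>

definition twin_class :: "'a pair_pre_digraph \<Rightarrow> 'a \<Rightarrow> 'a set" where
  "twin_class G u = {v. twin G u v}"

lemma twin_class_subset: "twin_class G u \<subseteq> pverts G"
  by (auto simp: twin_class_def dest: twin_in_verts)

lemma twin_class_eq:
  assumes "pair_graph G" "v \<in> twin_class G u"
  shows "twin_class G v = twin_class G u"
  using assms(2) twin_trans[OF assms(1)] twin_sym unfolding twin_class_def
  by (metis (mono_tags, lifting) Collect_cong mem_Collect_eq)

lemma twin_class_is_module: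
  assumes "pair_graph G"
  shows "is_module G (twin_class G u)"
  unfolding is_module_iff
proof (intro conjI ballI impI)
  fix v m n
  assume "v \<in> pverts G - twin_class G u" "m \<in> twin_class G u" "n \<in> twin_class G u"
    and "(v, m) \<in> parcs G"
  moreover from this have "twin G m n"
    using twin_trans[OF assms] twin_sym unfolding twin_class_def by (metis mem_Collect_eq)
  ultimately show "(v, n) \<in> parcs G"
    using twinD[of G m n v] by blast
qed (rule twin_class_subset)

text \<open>The pairs \<open>a\<close>, \<open>b\<close> and \<open>c\<close>, \<open>d\<close> are
  linked through the pair \<open>b\<close>, \<open>c\<close>; each link is a triangle of twins.
  Hence a twin class is a clique or stable.\<close>

lemma twin_class_adjacency:
  assumes G: "pair_graph G" and D: "a \<in> twin_class G u" "b \<in> twin_class G u"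
    "c \<in> twin_class G u" "d \<in> twin_class G u" and ne: "a \<noteq> b" "c \<noteq> d"
  shows "(a, b) \<in> parcs G \<longleftrightarrow> (c, d) \<in> parcs G"
proof -
  have tw: "twin G x y" if "x \<in> {a, b, c, d}" "y \<in> {a, b, c, d}" for x y
    using that D twin_trans[OF G, of x u y] twin_sym unfolding twin_class_def by fast
  have tri: "(x, y) \<in> parcs G \<longleftrightarrow> (y, z) \<in> parcs G"
    if "{x, y, z} \<subseteq> {a, b, c, d}" "x \<noteq> y" "y \<noteq> z" for x y z
    using that tw twin_triangle[OF G, of x y z] pair_graph_sym[OF G] by (cases "x = z") auto
  show ?thesis
  proof (cases "b = c")
    case True
    then show ?thesis using tri[of a b d] ne by auto
  next
    case False
    then show ?thesis using tri[of a b c] tri[of b c d] ne by auto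
  qed
qed

text \<open>This bounds the modular clique number and the modular stability number by
  \<open>m\<close> at once.\<close>

definition small_twin_modules :: "nat \<Rightarrow> 'a pair_pre_digraph \<Rightarrow> bool" where
  "small_twin_modules m G \<longleftrightarrow>
     (\<forall>M. is_module G M \<longrightarrow> is_clique G M \<or> is_stable G M \<longrightarrow> card M \<le> m)"

lemma twin_class_clique_or_stable:
  assumes G: "pair_graph G"
  shows "is_clique G (twin_class G u) \<or> is_stable G (twin_class G u)"
proof (rule disjCI)
  assume "\<not> is_stable G (twin_class G u)"
  then obtain a b where "a \<in> twin_class G u" "b \<in> twin_class G u" "(a, b) \<in> parcs G"
    using twin_class_subset[of G u] unfolding is_stable_def by blast
  moreover from this have "a \<noteq> b"
    using pair_graph_irrefl[OF G] by blast
  ultimately show "is_clique G (twin_class G u)"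
    using twin_class_adjacency[OF G] twin_class_subset[of G u]
    unfolding is_clique_def by blast
qed

lemma card_twin_class_le:
  "pair_graph G \<Longrightarrow> small_twin_modules m G \<Longrightarrow> card (twin_class G u) \<le> m"
  using twin_class_clique_or_stable[of G u] twin_class_is_module[of G u]
  unfolding small_twin_modules_def by blast

text \<open>A vertex outside \<open>M\<close> treats \<open>u\<close> and \<open>v\<close> alike
  because \<open>M\<close> is a module; one inside does because \<open>M\<close> is a clique or
  stable. So every such module lies in one twin class.\<close>

lemma clique_or_stable_module_twin:
  assumes "is_module G M" "is_clique G M \<or> is_stable G M" "u \<in> M" "v \<in> M"
  shows "twin G u v"
  unfolding twin_def is_module_iff
proof (intro conjI ballI impI)
  fix z m n
  assume z: "z \<in> pverts G - {u, v}" and mn: "m \<in> {u, v}" "n \<in> {u, v}" and e: "(z, m) \<in> parcs G"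
  then have "m \<in> M" "n \<in> M"
    using assms by auto
  show "(z, n) \<in> parcs G"
  proof (cases "z \<in> M")
    case False
    then show ?thesis
      using is_moduleD[OF assms(1)] z e \<open>m \<in> M\<close> \<open>n \<in> M\<close> by blast
  next
    case True
    then show ?thesis
      using assms(2) z mn e \<open>m \<in> M\<close> \<open>n \<in> M\<close> unfolding is_clique_def is_stable_def by blast
  qed
qed (use assms is_module_subset in blast)


subsection \<open>Extensions and complements\<close>

lemma is_extension_iff:
  "is_extension G H \<longleftrightarrow> pair_graph H \<and> pverts G \<subseteq> pverts H \<and>
     parcs G = parcs H \<inter> pverts G \<times> pverts G"
proof -
  have "{e \<in> parcs H. fst e \<in> pverts G \<and> snd e \<in> pverts G} = parcs H \<inter> pverts G \<times> pverts G"
    by auto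
  then show ?thesis
    unfolding is_extension_def with_proj_def induce_subgraph_def by auto
qed

lemma is_p_extension_trans:
  assumes "is_p_extension p G H" "is_p_extension q H K"
  shows "is_p_extension (q + p) G K"
proof -
  have e: "is_extension G H" "is_extension H K"
    using assms by (auto simp: is_p_extension_def)
  then have "is_extension G K"
    unfolding is_extension_iff by blast
  moreover have "pverts K - pverts G = (pverts K - pverts H) \<union> (pverts H - pverts G)"
    using e unfolding is_extension_iff by blast
  moreover have "finite (pverts K)"  "finite (pverts H)"
    using e pair_graph_finite unfolding is_extension_iff by blast+
  ultimately show ?thesis
    using assms by (auto simp: is_p_extension_def intro!: card_Un_disjoint)
qed

section \<open>Complements and isolated vertices\<close>

lemma pverts_complement [simp]: "pverts (complement G) = pverts G"
  by (simp add: complement_def)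

lemma parcs_complement:
  "(u, v) \<in> parcs (complement G) \<longleftrightarrow>
     u \<in> pverts G \<and> v \<in> pverts G \<and> u \<noteq> v \<and> (u, v) \<notin> parcs G"
  by (simp add: complement_def)

lemma pair_graph_complement: "pair_graph G \<Longrightarrow> pair_graph (complement G)"
  unfolding pair_graph_iff by (auto simp: complement_def sym_def irrefl_def)

lemma complement_complement: "pair_graph G \<Longrightarrow> complement (complement G) = G"
  unfolding pair_graph_iff irrefl_def by (cases G) (auto simp: complement_def)

text \<open>Complementation only swaps "adjacent to all" and "adjacent to none". Everything defined
  through modules is thus shared by \<open>G\<close> and its complement, which gives the symmetry
  used throughout.\<close>

lemma is_module_complement: "is_module (complement G) M \<longleftrightarrow> is_module G M"
proof -
  have "(v, m) \<in> parcs (complement G) \<longleftrightarrow> (v, m) \<notin> parcs G"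
    if "M \<subseteq> pverts G" "v \<in> pverts G - M" "m \<in> M" for v m
    using that by (auto simp: parcs_complement)
  then show ?thesis
    unfolding is_module_def pverts_complement by blast
qed

lemma prime_graph_complement: "prime_graph (complement G) \<longleftrightarrow> prime_graph G"
  by (simp add: prime_graph_def is_module_complement trivial_module_def)

lemma is_p_extension_complement:
  assumes "pair_graph G" "is_p_extension p G H"
  shows "is_p_extension p (complement G) (complement H)"
  using assms pair_graph_complement
  by (auto simp: is_p_extension_def is_extension_iff parcs_complement)

lemma is_clique_complement: "pair_graph G \<Longrightarrow> is_clique (complement G) M \<longleftrightarrow> is_stable G M"
  unfolding is_clique_def is_stable_def parcs_complement pverts_complement
  by (metis pair_graph_irrefl subsetD)

lemma is_stable_complement: "is_stable (complement G) M \<longleftrightarrow> is_clique G M"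
  by (auto simp: is_clique_def is_stable_def parcs_complement)

lemma small_twin_modules_complement:
  "pair_graph G \<Longrightarrow> small_twin_modules m (complement G) \<longleftrightarrow> small_twin_modules m G"
  by (auto simp: small_twin_modules_def is_module_complement is_clique_complement
      is_stable_complement)

definition isolated :: "'a pair_pre_digraph \<Rightarrow> 'a set" where
  "isolated G = {v \<in> pverts G. \<forall>u \<in> pverts G. (v, u) \<notin> parcs G}"

lemma num_isolated_eq: "num_isolated G = card (isolated G)"
  by (simp add: num_isolated_def isolated_def)

lemma isolated_complement:
  "isolated (complement G) = {v \<in> pverts G. \<forall>u \<in> pverts G. u \<noteq> v \<longrightarrow> (v, u) \<in> parcs G}"
  by (auto simp: isolated_def parcs_complement)

lemma isolated_module_stable:
  assumes "pair_graph G"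
  shows "is_module G (isolated G)" "is_stable G (isolated G)"
  using pair_graph_sym[OF assms]
  by (auto simp: is_module_iff is_stable_def isolated_def)

lemma num_isolated_le:
  assumes "pair_graph G" "small_twin_modules m G"
  shows "num_isolated G \<le> m"
  using assms isolated_module_stable[of G]
  unfolding small_twin_modules_def num_isolated_eq by blast

section \<open>Adding one vertex \<open>v\<close> with neighbourhood \<open>A\<close>\<close>

definition one_ext :: "'a pair_pre_digraph \<Rightarrow> 'a \<Rightarrow> 'a set \<Rightarrow> 'a pair_pre_digraph" where
  "one_ext G v A = \<lparr>pverts = insert v (pverts G), parcs = parcs G \<union> {v} \<times> A \<union> A \<times> {v}\<rparr>"

lemma pverts_one_ext [simp]: "pverts (one_ext G v A) = insert v (pverts G)"
  by (simp add: one_ext_def)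

lemma parcs_one_ext:
  assumes "pair_graph G" "v \<notin> pverts G" "A \<subseteq> pverts G" "x \<in> pverts G" "y \<in> pverts G"
  shows "(x, y) \<in> parcs (one_ext G v A) \<longleftrightarrow> (x, y) \<in> parcs G"
    and "(x, v) \<in> parcs (one_ext G v A) \<longleftrightarrow> x \<in> A"
    and "(v, x) \<in> parcs (one_ext G v A) \<longleftrightarrow> x \<in> A"
  using assms by (auto simp: one_ext_def dest: pair_graph_arc_in_verts)

lemma one_ext_is_p_extension:
  assumes "pair_graph G" "v \<notin> pverts G" "A \<subseteq> pverts G"
  shows "is_p_extension 1 G (one_ext G v A)"
proof -
  have "pair_graph (one_ext G v A)"
    using assms unfolding pair_graph_iff
    by (auto simp: one_ext_def sym_def irrefl_def)
  moreover have "insert v (pverts G) - pverts G = {v}"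
    using assms by auto
  moreover have "parcs G = parcs (one_ext G v A) \<inter> pverts G \<times> pverts G"
    using assms unfolding pair_graph_iff by (auto simp: one_ext_def)
  ultimately show ?thesis
    by (auto simp: is_p_extension_def is_extension_iff)
qed

lemma is_module_one_extD:
  assumes "pair_graph G" "v \<notin> pverts G" "A \<subseteq> pverts G" "is_module (one_ext G v A) M"
  shows "is_module G (M - {v})"
proof -
  have M: "M - {v} \<subseteq> pverts G"
    using is_module_subset[OF assms(4)] by auto
  show ?thesis
    unfolding is_module_iff
  proof (intro conjI ballI impI M)
    fix w m n
    assume "w \<in> pverts G - (M - {v})" "m \<in> M - {v}" "n \<in> M - {v}" "(w, m) \<in> parcs G"
    then show "(w, n) \<in> parcs G"
      using is_moduleD[OF assms(4), of w m n] parcs_one_ext(1)[OF assms(1-3), of w] M assms(2)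
      by auto
  qed
qed


subsection \<open>Prime extensions by one vertex\<close>

text \<open>
  If the module \<open>B\<close> is captured, then adding to \<open>B\<close> a new vertex with neighbourhood \<open>A\<close> gives a module
  of the extension.
\<close>

definition captured :: "'a pair_pre_digraph \<Rightarrow> 'a set \<Rightarrow> 'a set \<Rightarrow> bool" where
  "captured G A B \<longleftrightarrow> (\<forall>u \<in> pverts G - B. \<forall>b \<in> B. (u, b) \<in> parcs G \<longleftrightarrow> u \<in> A)"

definition splits :: "'a set \<Rightarrow> 'a set \<Rightarrow> bool" where
  "splits A M \<longleftrightarrow> M \<inter> A \<noteq> {} \<and> M - A \<noteq> {}"

text \<open>Let \<open>M\<close> be a nontrivial module of the extension. If \<open>v\<close> is not
  in \<open>M\<close>, then \<open>v\<close> sees all or none of \<open>M\<close>, so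
  \<open>A\<close> does not split it. If \<open>v\<close> is in \<open>M\<close>, an outside vertex
  sees \<open>M - {v}\<close> as it sees \<open>v\<close>, so \<open>M - {v}\<close> is
  captured.\<close>

lemma prime_one_extI:
  assumes G: "pair_graph G" "v \<notin> pverts G" "A \<subseteq> pverts G" and card: "3 \<le> card (pverts G)"
    and split: "\<And>M. is_module G M \<Longrightarrow> 2 \<le> card M \<Longrightarrow> splits A M"
    and capt: "\<And>B. is_module G B \<Longrightarrow> B \<noteq> {} \<Longrightarrow> B \<noteq> pverts G \<Longrightarrow> \<not> captured G A B"
  shows "prime_graph (one_ext G v A)"
  unfolding prime_graph_def
proof (intro conjI allI impI)
  show "4 \<le> card (pverts (one_ext G v A))"
    using G card pair_graph_finite[OF G(1)] by simp
  fix M assume M: "is_module (one_ext G v A) M"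
  let ?B = "M - {v}"
  have B: "is_module G ?B"
    using is_module_one_extD[OF G M] .
  have Msub: "M \<subseteq> insert v (pverts G)"
    using is_module_subset[OF M] by simp
  show "trivial_module (one_ext G v A) M"
  proof (rule ccontr)
    assume nt: "\<not> trivial_module (one_ext G v A) M"
    show False
    proof (cases "v \<in> M")
      case False
      then have MG: "is_module G M"
        using B by simp
      have "\<not> card M \<le> 1"
      proof
        assume "card M \<le> 1"
        then have "M = {} \<or> (\<exists>x. M = {x})"
          using is_module_finite[OF G(1) MG] by (metis card_1_singletonE card_0_eq le_neq_implies_less less_one)
        then show False
          using nt Msub by (auto simp: trivial_module_def)
      qed
      then have "splits A M"
        using split[OF MG] by simp
      then obtain x y where "x \<in> M" "x \<in> A" "y \<in> M" "y \<notin> A"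
        unfolding splits_def by blast
      then show False
        using is_moduleD[OF M, of v x y] False parcs_one_ext(3)[OF G] is_module_subset[OF MG]
        by auto
    next
      case True
      have "?B \<noteq> {}"
        using nt True by (auto simp: trivial_module_def)
      moreover have "?B \<noteq> pverts G"
        using nt True by (auto simp: trivial_module_def)
      ultimately obtain u b where ub: "u \<in> pverts G" "u \<notin> ?B" "b \<in> ?B"
          "\<not> ((u, b) \<in> parcs G \<longleftrightarrow> u \<in> A)"
        using capt[OF B] unfolding captured_def by blast
      moreover have "b \<in> pverts G"
        using ub(3) Msub by auto
      moreover have "(u, b) \<in> parcs (one_ext G v A) \<longleftrightarrow> (u, v) \<in> parcs (one_ext G v A)"
        using is_moduleD[OF M, of u b v] ub True G(2) by auto
      ultimately show False
        using parcs_one_ext(1,2)[OF G, of u b] by simp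
    qed
  qed
qed

section \<open>Minimal modules with at least two elements, and sets splitting them\<close>

definition minimal_module :: "'a pair_pre_digraph \<Rightarrow> 'a set \<Rightarrow> bool" where
  "minimal_module G M \<longleftrightarrow> is_module G M \<and> 2 \<le> card M \<and>
     (\<forall>N. is_module G N \<and> N \<subset> M \<longrightarrow> card N < 2)"

lemma module_contains_minimal:
  assumes G: "pair_graph G"
  shows "is_module G M \<Longrightarrow> 2 \<le> card M \<Longrightarrow> \<exists>N. minimal_module G N \<and> N \<subseteq> M"
proof (induction "card M" arbitrary: M rule: less_induct)
  case less
  show ?case
  proof (cases "minimal_module G M")
    case False
    then obtain N where N: "is_module G N" "N \<subset> M" "2 \<le> card N"
      using less.prems unfolding minimal_module_def by force
    moreover have "card N < card M"
      using psubset_card_mono[OF is_module_finite[OF G less.prems(1)] N(2)] .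
    ultimately show ?thesis
      using less.hyps[of N] by blast
  qed blast
qed

lemma card_less_2_iff:
  assumes "finite M" "x \<in> M"
  shows "card M < 2 \<longleftrightarrow> M = {x}"
proof
  assume "card M < 2"
  then have "card M = 1"
    using assms by (metis One_nat_def card_0_eq empty_iff less_2_cases)
  then show "M = {x}"
    using assms(2) by (metis card_1_singletonE singletonD)
qed simp

lemma minimal_module_sub:
  assumes "pair_graph G" "minimal_module G M" "is_module G N" "N \<subset> M" "x \<in> N"
  shows "N = {x}"
  using assms card_less_2_iff[OF is_module_finite[OF assms(1,3)] assms(5)]
  unfolding minimal_module_def by blast

text \<open>If \<open>M\<close> and \<open>N\<close> overlap, their intersection and both
  differences are smaller nonempty modules, hence singletons. Then \<open>M = {x, y}\<close> and
  \<open>N = {x, z}\<close>, so \<open>x\<close>, \<open>y\<close>, \<open>z\<close> lie in one twin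
  class, which has at most two elements.\<close>

lemma minimal_modules_disjoint:
  assumes G: "pair_graph G" and small: "small_twin_modules 2 G"
    and M: "minimal_module G M" and N: "minimal_module G N" and ne: "M \<noteq> N"
  shows "M \<inter> N = {}"
proof (rule ccontr)
  assume "M \<inter> N \<noteq> {}"
  then obtain x where x: "x \<in> M" "x \<in> N"
    by blast
  have mod: "is_module G M" "is_module G N" and card: "2 \<le> card M" "2 \<le> card N"
    using M N by (auto simp: minimal_module_def)
  have "\<not> M \<subset> N" "\<not> N \<subset> M"
    using M N unfolding minimal_module_def by (meson leD)+
  then have nsub: "\<not> M \<subseteq> N" "\<not> N \<subseteq> M"
    using ne by auto
  then obtain y z where y: "y \<in> M" "y \<notin> N" and z: "z \<in> N" "z \<notin> M"
    by blast
  have "M \<inter> N = {x}"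
    using minimal_module_sub[OF G M is_module_Int[OF mod]] x nsub by blast
  moreover have "M - N = {y}"
    using minimal_module_sub[OF G M is_module_Diff[OF G mod nsub(2)]] x y by blast
  moreover have "N - M = {z}"
    using minimal_module_sub[OF G N is_module_Diff[OF G mod(2,1) nsub(1)]] x z by blast
  ultimately have "M = {x, y}" "N = {x, z}"
    by blast+
  then have "{x, y, z} \<subseteq> twin_class G x"
    using mod is_module_subset[OF mod(1)] twin_refl[of x G] x
    by (auto simp: twin_class_def twin_def)
  moreover have "finite (twin_class G x)"
    using finite_subset[OF twin_class_subset pair_graph_finite[OF G]] .
  ultimately have "card {x, y, z} \<le> card (twin_class G x)"
    by (rule card_mono[rotated])
  moreover have "card {x, y, z} = 3"
    using x y z by (subst card_3_iff) metis
  ultimately show False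
    using card_twin_class_le[OF G small, of x] by simp
qed

text \<open>Choose one element of each minimal module. By disjointness each of them contains exactly
  one chosen element and, having at least two elements, also an unchosen one.\<close>

lemma ex_splitting_set:
  assumes G: "pair_graph G" and small: "small_twin_modules 2 G"
  shows "\<exists>A \<subseteq> \<Union>{M. minimal_module G M}. \<forall>M. minimal_module G M \<longrightarrow> splits A M"
proof -
  define f where "f M = (SOME x. x \<in> M)" for M :: "'a set"
  have f: "f M \<in> M" if "minimal_module G M" for M
    using that unfolding f_def minimal_module_def by (metis card.empty not_numeral_le_zero some_in_eq)
  define A where "A = f ` {M. minimal_module G M}"
  have "splits A M" if M: "minimal_module G M" for M
  proof -
    have "f N \<notin> M" if "minimal_module G N" "N \<noteq> M" for N
      using minimal_modules_disjoint[OF G small M that(1)] that f[of N] by blast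
    then have "M \<inter> A = {f M}"
      using M f[OF M] unfolding A_def by blast
    moreover have "M \<noteq> {f M}"
      using M unfolding minimal_module_def by (metis is_singletonI is_singleton_altdef numeral_le_one_iff semiring_norm(69))
    ultimately show ?thesis
      using f[OF M] unfolding splits_def by blast
  qed
  moreover have "A \<subseteq> \<Union>{M. minimal_module G M}"
    using f unfolding A_def by blast
  ultimately show ?thesis
    by blast
qed

lemma splits_module:
  assumes "pair_graph G" "\<And>M. minimal_module G M \<Longrightarrow> splits A M"
    and "is_module G M" "2 \<le> card M"
  shows "splits A M"
  using module_contains_minimal[OF assms(1,3,4)] assms(2) unfolding splits_def by blast

text \<open>If \<open>B\<close> missed \<open>M\<close>, a vertex of \<open>B\<close> would be
  adjacent exactly to those elements of \<open>M\<close> that lie in \<open>A\<close>; but it must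
  see all or none of \<open>M\<close>.\<close>

lemma captured_meets_split_module:
  assumes G: "pair_graph G" and B: "B \<subseteq> pverts G" "B \<noteq> {}" and capt: "captured G A B"
    and M: "is_module G M" and "splits A M"
  shows "B \<inter> M \<noteq> {}"
proof
  assume disj: "B \<inter> M = {}"
  obtain a c b where abc: "a \<in> M" "a \<in> A" "c \<in> M" "c \<notin> A" "b \<in> B"
    using assms unfolding splits_def by blast
  then have "(a, b) \<in> parcs G" "(c, b) \<notin> parcs G"
    using capt disj is_module_subset[OF M] unfolding captured_def by blast+
  then show False
    using is_moduleD[OF M, of b a c] pair_graph_sym[OF G] abc B disj by blast
qed

text \<open>\<open>C\<close> is a nonempty proper union of connected components; such a set
  witnesses disconnectedness.\<close>

definition separates :: "'a pair_pre_digraph \<Rightarrow> 'a set \<Rightarrow> bool" where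
  "separates G C \<longleftrightarrow> C \<subseteq> pverts G \<and> C \<noteq> {} \<and> C \<noteq> pverts G \<and>
     (\<forall>x \<in> C. \<forall>y \<in> pverts G - C. (x, y) \<notin> parcs G)"

lemma separates_Diff:
  assumes "pair_graph G" "separates G C"
  shows "separates G (pverts G - C)"
  using assms(2) pair_graph_sym[OF assms(1)] unfolding separates_def by blast

text \<open>
  A captured \<open>B\<close> meets every union of connected components. Hence no outside vertex is adjacent to \<open>B\<close>,
  so the outside is itself such a union, although \<open>B\<close> misses it.
\<close>

lemma not_captured_if_disconnected:
  assumes G: "pair_graph G" and C: "separates G C"
    and split: "\<And>M. is_module G M \<Longrightarrow> 2 \<le> card M \<Longrightarrow> splits A M" and iso: "isolated G \<subseteq> A"
    and B: "is_module G B" "B \<noteq> {}" "B \<noteq> pverts G"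
  shows "\<not> captured G A B"
proof
  assume capt: "captured G A B"
  have Bsub: "B \<subseteq> pverts G"
    using is_module_subset[OF B(1)] .
  have meets: "B \<inter> D \<noteq> {}" if D: "separates G D" for D
  proof -
    have mod: "is_module G D"
      using D pair_graph_sym[OF G] unfolding separates_def is_module_iff by blast
    show ?thesis
    proof (cases "2 \<le> card D")
      case True
      then show ?thesis
        using captured_meets_split_module[OF G Bsub B(2) capt mod] split[OF mod] by blast
    next
      case False
      \<comment> \<open>A one-element \<open>D\<close> consists of an isolated vertex. It lies in
        \<open>A\<close>, so if it were outside the captured \<open>B\<close> it would be adjacent
        to \<open>B\<close>.\<close>
      obtain i where i: "i \<in> D"
        using D by (auto simp: separates_def)
      then have Di: "D = {i}"
        using card_less_2_iff[OF is_module_finite[OF G mod] i] False by simp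
      then have "i \<in> isolated G"
        using D pair_graph_irrefl[OF G] unfolding separates_def isolated_def by blast
      then show ?thesis
        using capt iso B(2) Bsub Di unfolding captured_def isolated_def by blast
    qed
  qed
  obtain b c where bc: "b \<in> B" "b \<in> C" "c \<in> B" "c \<in> pverts G - C"
    using meets[OF C] meets[OF separates_Diff[OF G C]] by blast
  have "(x, y) \<notin> parcs G" if x: "x \<in> pverts G - B" and y: "y \<in> B" for x y
  proof -
    \<comment> \<open>\<open>b\<close> and \<open>c\<close> lie on opposite sides of
      \<open>C\<close>, so \<open>x\<close> misses one of them; capture makes \<open>x\<close> treat
      all of \<open>B\<close> alike.\<close>
    have "(x, b) \<notin> parcs G \<or> (x, c) \<notin> parcs G"
      using C bc x pair_graph_sym[OF G] unfolding separates_def by blast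
    then show ?thesis
      using capt x y bc unfolding captured_def by blast
  qed
  then have "separates G (pverts G - B)"
    using B Bsub unfolding separates_def by blast
  then show False
    using meets by blast
qed

text \<open>Removing an isolated vertex \<open>i\<close> from \<open>M\<close> leaves a module, by
  minimality a singleton \<open>{j}\<close>. Then \<open>j\<close> is a twin of \<open>i\<close> and
  is isolated too, giving two isolated vertices.\<close>

lemma minimal_module_avoids_isolated:
  assumes G: "pair_graph G" and iso: "num_isolated G < 2" and M: "minimal_module G M"
  shows "M \<inter> isolated G = {}"
proof (rule ccontr)
  assume "M \<inter> isolated G \<noteq> {}"
  then obtain i where i: "i \<in> M" "i \<in> isolated G"
    by blast
  have mod: "is_module G M"
    using M by (simp add: minimal_module_def)
  have "M \<noteq> {i}"
    using M by (auto simp: minimal_module_def)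
  then obtain j where j: "j \<in> M" "j \<noteq> i"
    using i by blast
  have "is_module G (M - {i})"
    using mod i pair_graph_sym[OF G] unfolding is_module_iff isolated_def by blast
  then have "M - {i} = {j}"
    using minimal_module_sub[OF G M, of "M - {i}" j] i j by blast
  then have Mij: "M = {i, j}"
    using i by blast
  have "(j, u) \<notin> parcs G" if u: "u \<in> pverts G" for u
  proof (cases "u \<in> M")
    case True
    then show ?thesis
      using Mij i j is_module_subset[OF mod] pair_graph_sym[OF G] pair_graph_irrefl[OF G]
      unfolding isolated_def by blast
  next
    case False
    then show ?thesis
      using is_moduleD[OF mod u False i(1) j(1)] i(2) pair_graph_sym[OF G] u
      unfolding isolated_def by blast
  qed
  then have "j \<in> isolated G"
    using j is_module_subset[OF mod] unfolding isolated_def by blast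
  moreover have "finite (isolated G)"
    using pair_graph_finite[OF G] by (simp add: isolated_def)
  ultimately show False
    using card_less_2_iff[of "isolated G" i] iso i j unfolding num_isolated_eq by blast
qed

lemma ex_prime_1_extensionI:
  fixes G :: "'a::infinite pair_pre_digraph"
  assumes G: "pair_graph G" and "A \<subseteq> pverts G" and "3 \<le> card (pverts G)"
    and "\<And>M. is_module G M \<Longrightarrow> 2 \<le> card M \<Longrightarrow> splits A M"
    and "\<And>B. is_module G B \<Longrightarrow> B \<noteq> {} \<Longrightarrow> B \<noteq> pverts G \<Longrightarrow> \<not> captured G A B"
  shows "\<exists>H. is_p_extension 1 G H \<and> prime_graph H"
proof -
  obtain v where "v \<notin> pverts G"
    using ex_new_if_finite[OF infinite_UNIV pair_graph_finite[OF G]] by blast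
  then show ?thesis
    using one_ext_is_p_extension[OF G _ assms(2)] prime_one_extI[OF G _ assms(2-5)] by blast
qed

lemma ex_prime_1_extension_disconnected:
  fixes G :: "'a::infinite pair_pre_digraph"
  assumes G: "pair_graph G" and card: "3 \<le> card (pverts G)" and small: "small_twin_modules 2 G"
    and iso: "num_isolated G < 2" and C: "separates G C"
  shows "\<exists>H. is_p_extension 1 G H \<and> prime_graph H"
proof -
  obtain S where S: "S \<subseteq> \<Union>{M. minimal_module G M}" "\<And>M. minimal_module G M \<Longrightarrow> splits S M"
    using ex_splitting_set[OF G small] by blast
  \<comment> \<open>An isolated vertex not joined to the new vertex would stay isolated. Minimal
    modules avoid these vertices, so adding them to \<open>S\<close> does not disturb the
    splitting.\<close>
  define A where "A = S \<union> isolated G"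
  have "splits A M" if "minimal_module G M" for M
    using S(2)[OF that] minimal_module_avoids_isolated[OF G iso that] unfolding A_def splits_def
    by blast
  then have split: "splits A M" if "is_module G M" "2 \<le> card M" for M
    using splits_module[OF G _ that] by blast
  have "A \<subseteq> pverts G"
    using S(1) is_module_subset unfolding A_def isolated_def minimal_module_def by blast
  then show ?thesis
    using ex_prime_1_extensionI[OF G _ card split] not_captured_if_disconnected[OF G C split]
    unfolding A_def by blast
qed

text \<open>Otherwise \<open>B \<union> P\<close> is a module larger than \<open>P\<close>, hence
  the whole vertex set. Then \<open>P\<close> and its complement \<open>B - P\<close> are both
  modules, joined completely or not at all, so \<open>G\<close> or its complement is
  disconnected.\<close>

lemma module_subset_maximal_module:
  assumes G: "pair_graph G" and conn: "\<nexists>C. separates G C" "\<nexists>C. separates (complement G) C"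
    and P: "is_module G P" "P \<noteq> pverts G"
    and max: "\<And>Q. is_module G Q \<Longrightarrow> P \<subseteq> Q \<Longrightarrow> Q \<noteq> pverts G \<Longrightarrow> Q = P"
    and B: "is_module G B" "B \<noteq> pverts G" "B \<inter> P \<noteq> {}"
  shows "B \<subseteq> P"
proof (rule ccontr)
  assume "\<not> B \<subseteq> P"
  then have un: "B \<union> P = pverts G"
    using max[OF is_module_Un[OF B(1) P(1) B(3)]] by blast
  then have nsub: "\<not> P \<subseteq> B"
    using B(2) by blast
  have Q: "is_module G (B - P)"
    using is_module_Diff[OF G B(1) P(1) nsub] .
  obtain p q where pq: "p \<in> P" "q \<in> B - P"
    using B(3) \<open>\<not> B \<subseteq> P\<close> by blast
  have "(x, y) \<in> parcs G \<longleftrightarrow> (p, q) \<in> parcs G" if "x \<in> P" "y \<in> B - P" for x y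
    using that pq is_moduleD[OF P(1), of y x p] is_moduleD[OF Q, of p y q] un pair_graph_sym[OF G]
    by blast
  moreover have "pverts G - P = B - P" "P \<subseteq> pverts G" "P \<noteq> {}"
    using un pq by blast+
  ultimately have "separates G P \<or> separates (complement G) P"
    using P(2) unfolding separates_def parcs_complement pverts_complement by blast
  then show False
    using conn by blast
qed

text \<open>Take a maximal proper module \<open>P\<close> around a minimal module \<open>M\<close>.
  A captured \<open>B\<close> meets \<open>M\<close>, hence lies in \<open>P\<close>, and then
  \<open>P\<close> is captured as well. So it is enough that \<open>A\<close> splits the minimal
  modules without capturing the single set \<open>P\<close>.\<close>

lemma ex_prime_1_extension_connected:
  fixes G :: "'a::infinite pair_pre_digraph"
  assumes G: "pair_graph G" and card: "3 \<le> card (pverts G)" and small: "small_twin_modules 2 G"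
    and conn: "\<nexists>C. separates G C" "\<nexists>C. separates (complement G) C"
    and R: "is_module G R" "2 \<le> card R" "R \<noteq> pverts G"
  shows "\<exists>H. is_p_extension 1 G H \<and> prime_graph H"
proof -
  obtain M where M: "minimal_module G M" "M \<subseteq> R"
    using module_contains_minimal[OF G R(1,2)] by blast
  let ?F = "{P. is_module G P \<and> M \<subseteq> P \<and> P \<noteq> pverts G}"
  have "?F \<subseteq> Pow (pverts G)"
    using is_module_subset by blast
  then have fin: "finite ?F"
    using pair_graph_finite[OF G] by (meson finite_Pow_iff finite_subset)
  have "R \<in> ?F"
    using M R by simp
  then obtain P where "P \<in> ?F" and max: "\<And>Q. Q \<in> ?F \<Longrightarrow> P \<subseteq> Q \<Longrightarrow> P = Q"
    using finite_has_maximal2[OF fin] by meson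
  then have P: "is_module G P" "M \<subseteq> P" "P \<noteq> pverts G"
    by auto
  have below: "B \<subseteq> P" if "is_module G B" "B \<noteq> pverts G" "B \<inter> P \<noteq> {}" for B
  proof (rule module_subset_maximal_module[OF G conn P(1,3) _ that])
    show "Q = P" if "is_module G Q" "P \<subseteq> Q" "Q \<noteq> pverts G" for Q
      using max[of Q] that P(2) by auto
  qed
  have Mmod: "is_module G M" "2 \<le> card M"
    using M by (auto simp: minimal_module_def)
  then have "M \<noteq> {}"
    by auto
  \<comment> \<open>The whole vertex set properly contains \<open>M\<close>, so it is not
    minimal.\<close>
  have proper: "N \<noteq> pverts G" if "minimal_module G N" for N
  proof
    assume "N = pverts G"
    then have "M \<subset> N"
      using P is_module_subset[OF P(1)] by blast
    then show False
      using that Mmod unfolding minimal_module_def by (meson leD)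
  qed
  obtain S where S: "S \<subseteq> \<Union>{M. minimal_module G M}" "\<And>M. minimal_module G M \<Longrightarrow> splits S M"
    using ex_splitting_set[OF G small] by blast
  have Ssub: "S \<subseteq> pverts G"
    using S(1) is_module_subset unfolding minimal_module_def by blast
  obtain A where A: "A \<subseteq> pverts G" "\<not> captured G A P"
    and Asplit: "\<And>M. minimal_module G M \<Longrightarrow> splits A M"
  proof (cases "captured G S P")
    case False
    then show ?thesis
      using that[of S] S(2) Ssub by blast
  next
    case True
    \<comment> \<open>All minimal modules then lie inside \<open>P\<close>, so a vertex outside \<open>P\<close> can be toggled freely.\<close>
    obtain y where y: "y \<in> pverts G" "y \<notin> P"
      using P is_module_subset[OF P(1)] by blast
    have "y \<notin> N" if N: "minimal_module G N" for N
    proof -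
      have Nmod: "is_module G N"
        using N by (simp add: minimal_module_def)
      have "P \<inter> N \<noteq> {}"
        using captured_meets_split_module[OF G is_module_subset[OF P(1)] _ True Nmod S(2)[OF N]]
          P(2) \<open>M \<noteq> {}\<close> by blast
      then show ?thesis
        using below[OF Nmod proper[OF N]] y by blast
    qed
    then have "splits (if y \<in> S then S - {y} else insert y S) N" if "minimal_module G N" for N
      using S(2)[OF that] that unfolding splits_def by auto
    \<comment> \<open>The toggle reverses the condition of \<open>captured\<close> at the outside
      vertex \<open>y\<close>.\<close>
    moreover have "\<not> captured G (if y \<in> S then S - {y} else insert y S) P"
      using True y P(2) \<open>M \<noteq> {}\<close> unfolding captured_def by auto
    moreover have "(if y \<in> S then S - {y} else insert y S) \<subseteq> pverts G"
      using Ssub y by auto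
    ultimately show ?thesis
      using that by blast
  qed
  have split: "splits A N" if "is_module G N" "2 \<le> card N" for N
    using splits_module[OF G Asplit that] .
  have "\<not> captured G A B" if B: "is_module G B" "B \<noteq> {}" "B \<noteq> pverts G" for B
  proof
    assume capt: "captured G A B"
    have "B \<inter> M \<noteq> {}"
      using captured_meets_split_module[OF G is_module_subset[OF B(1)] B(2) capt Mmod(1)]
        Asplit[OF M(1)] by blast
    then have BP: "B \<subseteq> P"
      using below[OF B(1,3)] P(2) by blast
    obtain b where b: "b \<in> B"
      using B(2) by blast
    have "(u, p) \<in> parcs G \<longleftrightarrow> u \<in> A" if "u \<in> pverts G - P" "p \<in> P" for u p
      using is_moduleD[OF P(1), of u p b] that b BP capt unfolding captured_def by blast
    then show False
      using A(2) unfolding captured_def by blast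
  qed
  then show ?thesis
    using ex_prime_1_extensionI[OF G A(1) card split] by blast
qed

section \<open>Prime graphs: a counting argument\<close>

lemma two_mult_add_two_less_power: "4 \<le> n \<Longrightarrow> 2 * n + 2 < 2 ^ n" for n :: nat
  by (induction n rule: dec_induct) auto

text \<open>All modules being trivial, only \<open>2 * n + 2\<close> neighbourhoods are unsuitable
  for the new vertex on \<open>n\<close> vertices, fewer than the \<open>2 ^ n\<close> subsets
  because \<open>n \<ge> 4\<close>.\<close>

lemma ex_prime_1_extension_prime:
  fixes G :: "'a::infinite pair_pre_digraph"
  assumes G: "pair_graph G" and prime: "prime_graph G"
  shows "\<exists>H. is_p_extension 1 G H \<and> prime_graph H"
proof -
  let ?V = "pverts G"
  define nb where "nb x = {y. (y, x) \<in> parcs G}" for x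
  have fin: "finite ?V"
    using pair_graph_finite[OF G] .
  \<comment> \<open>\<open>{}\<close> and \<open>?V\<close> do not split the module
    \<open>?V\<close>; the open and the closed neighbourhood of \<open>x\<close> are the sets that
    capture \<open>{x}\<close>.\<close>
  let ?bad = "{{}, ?V} \<union> nb ` ?V \<union> (\<lambda>x. insert x (nb x)) ` ?V"
  have "card ?bad \<le> card {{}, ?V} + card (nb ` ?V) + card ((\<lambda>x. insert x (nb x)) ` ?V)"
    by (meson card_Un_le le_trans add_le_mono1)
  also have "\<dots> \<le> 2 + card ?V + card ?V"
    using fin by (intro add_mono card_image_le) (auto simp: card_insert_if)
  also have "\<dots> < card (Pow ?V)"
    using two_mult_add_two_less_power[of "card ?V"] prime fin
    by (simp add: card_Pow prime_graph_def)
  finally have "\<not> Pow ?V \<subseteq> ?bad"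
    using fin card_mono[of ?bad "Pow ?V"] by auto
  then obtain A where A: "A \<subseteq> ?V" "A \<notin> ?bad"
    by blast
  have triv: "M = {} \<or> M = ?V \<or> (\<exists>x \<in> ?V. M = {x})" if "is_module G M" for M
    using that prime by (simp add: prime_graph_def trivial_module_def)
  have "splits A M" if M: "is_module G M" "2 \<le> card M" for M
    using triv[OF M(1)] M(2) A unfolding splits_def by auto
  moreover have "\<not> captured G A B" if B: "is_module G B" "B \<noteq> {}" "B \<noteq> ?V" for B
  proof
    assume capt: "captured G A B"
    obtain x where x: "x \<in> ?V" "B = {x}"
      using triv[OF B(1)] B by blast
    then have "A - {x} = nb x"
      using capt A(1) pair_graph_irrefl[OF G] pair_graph_arc_in_verts[OF G]
      unfolding captured_def nb_def by blast
    then have "A = nb x \<or> A = insert x (nb x)"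
      by blast
    then show False
      using A(2) x(1) by blast
  qed
  ultimately show ?thesis
    using ex_prime_1_extensionI[OF G A(1)] prime by (simp add: prime_graph_def)
qed

text \<open>Two of the three pairs of vertices agree in adjacency. They share a vertex, and the
  other two vertices form a module.\<close>

lemma ex_module_of_card_2:
  assumes G: "pair_graph G" and "card (pverts G) = 3"
  shows "\<exists>M. is_module G M \<and> card M = 2"
proof -
  obtain a b c where abc: "pverts G = {a, b, c}" "a \<noteq> b" "a \<noteq> c" "b \<noteq> c"
    using assms(2) by (auto simp: card_3_iff)
  have "is_module G {a, b} \<or> is_module G {a, c} \<or> is_module G {b, c}"
    using abc pair_graph_sym[OF G, of a b] pair_graph_sym[OF G, of a c] pair_graph_sym[OF G, of b c]
    unfolding is_module_iff by auto
  then show ?thesis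
    using abc by (metis card_2_iff)
qed

text \<open>The case \<open>k = 1\<close> of the construction: disconnected graphs, then those with
  disconnected complement by symmetry, then prime graphs, then the rest, which have a proper module
  with two or more elements.\<close>

lemma ex_prime_1_extension:
  fixes G :: "'a::infinite pair_pre_digraph"
  assumes G: "pair_graph G" and card: "3 \<le> card (pverts G)" and small: "small_twin_modules 2 G"
    and iso: "num_isolated G < 2" "num_isolated (complement G) < 2"
  shows "\<exists>H. is_p_extension 1 G H \<and> prime_graph H"
proof (cases "(\<exists>C. separates G C) \<or> (\<exists>C. separates (complement G) C)")
  case True
  then show ?thesis
  proof
    assume "\<exists>C. separates G C"
    then show ?thesis
      using ex_prime_1_extension_disconnected[OF G card small iso(1)] by blast
  next
    assume "\<exists>C. separates (complement G) C"
    then obtain H where "is_p_extension 1 (complement G) H" "prime_graph H"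
      using ex_prime_1_extension_disconnected[OF pair_graph_complement[OF G]] card iso(2) small
        small_twin_modules_complement[OF G] by auto
    then show ?thesis
      using is_p_extension_complement[OF pair_graph_complement[OF G], of 1 H]
        complement_complement[OF G] prime_graph_complement by metis
  qed
next
  case conn: False
  show ?thesis
  proof (cases "prime_graph G")
    case True
    then show ?thesis
      using ex_prime_1_extension_prime[OF G] by blast
  next
    case False
    have "\<exists>R. is_module G R \<and> 2 \<le> card R \<and> R \<noteq> pverts G"
    \<comment> \<open>A graph on three vertices fails \<open>prime_graph\<close> by its size alone,
      so its proper module has to be found separately.\<close>
    proof (cases "card (pverts G) = 3")
      case True
      then show ?thesis
        using ex_module_of_card_2[OF G True] by force
    next
      case 3: False
      then obtain R where R: "is_module G R" "\<not> trivial_module G R"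
        using False card unfolding prime_graph_def by force
      then obtain x where x: "x \<in> R"
        by (auto simp: trivial_module_def)
      then have "R \<noteq> {x}" "R \<noteq> pverts G"
        using R is_module_subset[OF R(1)] by (auto simp: trivial_module_def)
      then show ?thesis
        using card_less_2_iff[OF is_module_finite[OF G R(1)] x] R(1) by force
    qed
    then show ?thesis
      using ex_prime_1_extension_connected[OF G card small] conn by blast
  qed
qed


subsection \<open>Halving the twin classes\<close>

text \<open>This lets the halving of twin classes also control the number of isolated
  vertices.\<close>

lemma twin_class_isolated:
  assumes G: "pair_graph G" and i: "i \<in> isolated G"
  shows "twin_class G i = isolated G"
proof
  show "isolated G \<subseteq> twin_class G i"
    using clique_or_stable_module_twin[OF isolated_module_stable(1)[OF G]]
      isolated_module_stable(2)[OF G] i unfolding twin_class_def by blast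
  show "twin_class G i \<subseteq> isolated G"
  proof
    fix v assume "v \<in> twin_class G i"
    then have tw: "twin G i v"
      by (simp add: twin_class_def)
    have "(v, u) \<notin> parcs G" if u: "u \<in> pverts G" for u
      using twinD[OF tw u] i u twin_in_verts[OF tw] pair_graph_sym[OF G] pair_graph_irrefl[OF G]
      unfolding isolated_def by blast
    then show "v \<in> isolated G"
      using twin_in_verts[OF tw] by (simp add: isolated_def)
  qed
qed

lemma twin_class_complement: "twin_class (complement G) u = twin_class G u"
  by (simp add: twin_class_def twin_def is_module_complement)

lemma twin_class_finite: "pair_graph G \<Longrightarrow> finite (twin_class G u)"
  by (rule finite_subset[OF twin_class_subset pair_graph_finite])

text \<open>Distinct twin classes are disjoint, so subsets of prescribed sizes can be chosen class
  by class without interfering.\<close>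

lemma ex_twin_class_selection:
  assumes G: "pair_graph G" and le: "\<And>D. f D \<le> card D"
  shows "\<exists>A \<subseteq> pverts G. \<forall>u. card (twin_class G u \<inter> A) = f (twin_class G u)"
proof -
  have "\<exists>S \<subseteq> D. card S = f D" for D
    using le[of D] by (meson obtain_subset_with_card_n)
  then obtain h where h: "\<And>D. h D \<subseteq> D" "\<And>D. card (h D) = f D"
    by metis
  define A where "A = (\<Union>u. h (twin_class G u))"
  have "twin_class G u \<inter> A = h (twin_class G u)" for u
  proof
    show "h (twin_class G u) \<subseteq> twin_class G u \<inter> A"
      using h(1) unfolding A_def by blast
    show "twin_class G u \<inter> A \<subseteq> h (twin_class G u)"
    proof
      fix x assume "x \<in> twin_class G u \<inter> A"
      then obtain w where w: "x \<in> twin_class G u" "x \<in> h (twin_class G w)"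
        unfolding A_def by blast
      then have "x \<in> twin_class G w"
        using h(1) by blast
      then have "twin_class G w = twin_class G u"
        using twin_class_eq[OF G] w(1) by metis
      then show "x \<in> h (twin_class G u)"
        using w(2) by simp
    qed
  qed
  moreover have "A \<subseteq> pverts G"
    using h(1) twin_class_subset unfolding A_def by (meson UN_least order_trans)
  ultimately show ?thesis
    using h(2) by metis
qed

text \<open>Once a vertex with neighbourhood \<open>A\<close> is added, isolated vertices of
  \<open>G\<close> survive only outside \<open>A\<close>, and those of the complement only inside
  \<open>A\<close>. Hence the two strict bounds concern opposite sides.\<close>

lemma ex_halving_set:
  assumes G: "pair_graph G" and card: "2 \<le> card (pverts G)"
    and small: "small_twin_modules (2 * n) G"
    and iso: "num_isolated G < 2 * n" "num_isolated (complement G) < 2 * n"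
  shows "\<exists>A \<subseteq> pverts G. A \<noteq> {} \<and> A \<noteq> pverts G \<and>
    (\<forall>u. 2 \<le> card (twin_class G u) \<longrightarrow> splits A (twin_class G u) \<and>
       card (twin_class G u \<inter> A) \<le> n \<and> card (twin_class G u - A) \<le> n \<and>
       (twin_class G u = isolated G \<longrightarrow> card (twin_class G u - A) < n) \<and>
       (twin_class G u = isolated (complement G) \<longrightarrow> card (twin_class G u \<inter> A) < n))"
proof (cases "\<exists>u. 2 \<le> card (twin_class G u)")
  \<comment> \<open>No twin class has two elements, so any nonempty proper subset will do.\<close>
  case False
  have "pverts G \<noteq> {}"
    using card by auto
  then obtain a where a: "a \<in> pverts G"
    by blast
  then have "{a} \<noteq> pverts G"
    using card by (metis card_1_singleton_iff One_nat_def not_less_eq_eq numeral_2_eq_2 order_refl)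
  then show ?thesis
    using a False by (intro exI[of _ "{a}"]) auto
next
  case True
  \<comment> \<open>Rounding up only for the isolated vertices keeps both strict bounds.\<close>
  define f where "f D = (if D = isolated G then Suc (card D) else card D) div 2" for D
  have "Suc m div 2 \<le> m" for m :: nat
    by presburger
  then have "f D \<le> card D" for D
    by (simp add: f_def)
  then obtain A where A: "A \<subseteq> pverts G" "\<And>u. card (twin_class G u \<inter> A) = f (twin_class G u)"
    using ex_twin_class_selection[OF G, of f] by blast
  have "splits A D \<and> card (D \<inter> A) \<le> n \<and> card (D - A) \<le> n \<and>
       (D = isolated G \<longrightarrow> card (D - A) < n) \<and>
       (D = isolated (complement G) \<longrightarrow> card (D \<inter> A) < n)"
    if D: "D = twin_class G u" and D2: "2 \<le> card D" for D u
  proof -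
    have fin: "finite D"
      using twin_class_finite[OF G] D by simp
    have cA: "card (D \<inter> A) = f D"
      using A(2) D by simp
    have cD: "card (D - A) = card D - f D"
      using card_Diff_subset_Int[of D A] fin cA by simp
    have le: "card D \<le> 2 * n"
      using card_twin_class_le[OF G small] D by simp
    have lt: "card D < 2 * n" if "D = isolated G \<or> D = isolated (complement G)"
      using that iso unfolding num_isolated_eq by auto
    \<comment> \<open>Two distinct vertices cannot be both adjacent and nonadjacent, so the class
      rounded up is not the one that must be rounded down.\<close>
    have ne: "isolated (complement G) \<noteq> D" if "D = isolated G"
    proof
      assume "isolated (complement G) = D"
      moreover obtain x y where "x \<in> D" "y \<in> D" "x \<noteq> y"
        using D2 by (meson card_2_iff' obtain_subset_with_card_n subset_iff)
      ultimately show False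
        using that unfolding isolated_complement unfolding isolated_def by blast
    qed
    have "1 \<le> f D" "f D < card D"
      using D2 by (auto simp: f_def)
    then have "D \<inter> A \<noteq> {}" "D - A \<noteq> {}"
      using cA cD by (metis card.empty not_one_le_zero, metis card.empty diff_is_0_eq leD)
    then have "splits A D"
      by (simp add: splits_def)
    moreover have "card (D \<inter> A) \<le> n" "card (D - A) \<le> n"
      using le lt unfolding cA cD f_def by auto
    moreover have "card (D - A) < n" if "D = isolated G"
      using lt that unfolding cD f_def by auto
    moreover have "card (D \<inter> A) < n" if "D = isolated (complement G)"
      using lt that ne unfolding cA f_def by auto
    ultimately show ?thesis
      by blast
  qed
  then have all: "\<forall>u. 2 \<le> card (twin_class G u) \<longrightarrow> splits A (twin_class G u) \<and>
       card (twin_class G u \<inter> A) \<le> n \<and> card (twin_class G u - A) \<le> n \<and>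
       (twin_class G u = isolated G \<longrightarrow> card (twin_class G u - A) < n) \<and>
       (twin_class G u = isolated (complement G) \<longrightarrow> card (twin_class G u \<inter> A) < n)"
    by blast
  obtain u where "splits A (twin_class G u)"
    using True all by blast
  then have "A \<noteq> {}" "A \<noteq> pverts G"
    using twin_class_subset[of G u] unfolding splits_def by blast+
  then show ?thesis
    using A(1) all by blast
qed

text \<open>A clique or stable module of the extension that avoids \<open>v\<close> lies in one half
  of a twin class of \<open>G\<close>. One that contains \<open>v\<close> and has more than
  \<open>n\<close> elements would make \<open>v\<close> see a whole twin class uniformly, although
  \<open>A\<close> splits it.\<close>

lemma ex_halving_1_extension:
  fixes G :: "'a::infinite pair_pre_digraph"
  assumes G: "pair_graph G" and card: "2 \<le> card (pverts G)" and n: "2 \<le> n"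
    and small: "small_twin_modules (2 * n) G"
    and iso: "num_isolated G < 2 * n" "num_isolated (complement G) < 2 * n"
  shows "\<exists>H. is_p_extension 1 G H \<and> small_twin_modules n H \<and>
    num_isolated H < n \<and> num_isolated (complement H) < n"
proof -
  obtain A where A: "A \<subseteq> pverts G" "A \<noteq> {}" "A \<noteq> pverts G"
    and cls: "\<And>u. 2 \<le> card (twin_class G u) \<Longrightarrow> splits A (twin_class G u) \<and>
       card (twin_class G u \<inter> A) \<le> n \<and> card (twin_class G u - A) \<le> n \<and>
       (twin_class G u = isolated G \<longrightarrow> card (twin_class G u - A) < n) \<and>
       (twin_class G u = isolated (complement G) \<longrightarrow> card (twin_class G u \<inter> A) < n)"
    using ex_halving_set[OF G card small iso] by blast
  obtain v where v: "v \<notin> pverts G"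
    using ex_new_if_finite[OF infinite_UNIV pair_graph_finite[OF G]] by blast
  let ?H = "one_ext G v A"
  note arcs = parcs_one_ext[OF G v A(1)]
  have ext: "is_p_extension 1 G ?H"
    using one_ext_is_p_extension[OF G v A(1)] .
  then have H: "pair_graph ?H"
    by (simp add: is_p_extension_def is_extension_iff)
  have "card M \<le> n" if M: "is_module ?H M" and cs: "is_clique ?H M \<or> is_stable ?H M" for M
  proof -
    have finM: "finite M"
      using is_module_finite[OF H M] .
    have NG: "is_module G (M - {v})"
      using is_module_one_extD[OF G v A(1) M] .
    have "(x, y) \<in> parcs ?H \<longleftrightarrow> (x, y) \<in> parcs G" if "x \<in> M - {v}" "y \<in> M - {v}" for x y
      using that is_module_subset[OF NG] arcs(1)[of x y] by blast
    then have "is_clique G (M - {v}) \<or> is_stable G (M - {v})"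
      using cs is_module_subset[OF NG] unfolding is_clique_def is_stable_def by blast
    then have tw: "twin G x y" if "x \<in> M - {v}" "y \<in> M - {v}" for x y
      using clique_or_stable_module_twin[OF NG] that by blast
    show ?thesis
    proof (cases "v \<in> M")
      case False
      show ?thesis
      proof (cases "2 \<le> card M")
        case True
        then obtain x where x: "x \<in> M"
          by fastforce
        let ?D = "twin_class G x"
        have MD: "M \<subseteq> ?D"
          using tw x False unfolding twin_class_def by blast
        then have D2: "2 \<le> card ?D"
          using card_mono[OF twin_class_finite[OF G] MD] True by simp
        have MV: "M \<subseteq> pverts G"
          using is_module_subset[OF NG] False by simp
        have "m \<in> A \<longleftrightarrow> x \<in> A" if "m \<in> M" for m
          using is_moduleD[OF M, of v m x] arcs(3)[of m m] arcs(3)[of x x] that x False MV by auto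
        then have "M \<subseteq> ?D \<inter> A \<or> M \<subseteq> ?D - A"
          using MD by blast
        then have "card M \<le> card (?D \<inter> A) \<or> card M \<le> card (?D - A)"
          using twin_class_finite[OF G, of x] by (auto intro: card_mono)
        then show ?thesis
          using cls[OF D2] by linarith
      next
        case False
        then show ?thesis
          using n by simp
      qed
    next
      case True
      show ?thesis
      proof (rule ccontr)
        assume "\<not> card M \<le> n"
        \<comment> \<open>As \<open>n \<ge> 2\<close>, \<open>M\<close> has at least three
          elements.\<close>
        then have "2 \<le> card (M - {v})"
          using True finM n by (simp add: card_Diff_singleton)
        then obtain c d where cd: "c \<in> M - {v}" "d \<in> M - {v}" "c \<noteq> d"
          by (meson card_2_iff' obtain_subset_with_card_n subset_iff)
        then have cdV: "c \<in> pverts G" "d \<in> pverts G"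
          using is_module_subset[OF NG] by blast+
        let ?D = "twin_class G c"
        have cdD: "c \<in> ?D" "d \<in> ?D"
          using tw cd unfolding twin_class_def by blast+
        then have "card {c, d} \<le> card ?D"
          using twin_class_finite[OF G] by (intro card_mono) auto
        then have "splits A ?D"
          using cls[of c] cd(3) by simp
        moreover have twH: "twin ?H x y" if "x \<in> M" "y \<in> M" for x y
          using clique_or_stable_module_twin[OF M cs that] .
        \<comment> \<open>Whether \<open>v\<close> sees \<open>b\<close> depends only on whether the
          class is a clique: for \<open>b = c\<close> by the triangle \<open>v\<close>,
          \<open>c\<close>, \<open>d\<close>, otherwise because \<open>b\<close> sees the twins
          \<open>c\<close> and \<open>v\<close> alike. So \<open>A\<close> contains all of the class
          or none of it.\<close>
        have "b \<in> A \<longleftrightarrow> (c, d) \<in> parcs G" if b: "b \<in> ?D" for b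
        proof (cases "b = c")
          case True
          have "(v, c) \<in> parcs ?H \<longleftrightarrow> (c, d) \<in> parcs ?H"
            using cd \<open>v \<in> M\<close> by (intro twin_triangle[OF H] twH) auto
          then show ?thesis
            using arcs(1,3) cdV True by blast
        next
          case False
          have bV: "b \<in> pverts G"
            using b twin_class_subset[of G c] by blast
          have "twin ?H c v"
            using twH cd \<open>v \<in> M\<close> by blast
          then have "(b, c) \<in> parcs ?H \<longleftrightarrow> (b, v) \<in> parcs ?H"
            using twinD[of ?H c v b] False bV v by auto
          moreover have "(b, c) \<in> parcs G \<longleftrightarrow> (c, d) \<in> parcs G"
            using twin_class_adjacency[OF G b cdD(1) cdD] False cd(3) by blast
          ultimately show ?thesis
            using arcs(1,2) bV cdV by blast
        qed
        ultimately show False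
          unfolding splits_def by blast
      qed
    qed
  qed
  then have "small_twin_modules n ?H"
    unfolding small_twin_modules_def by blast
  moreover have "num_isolated ?H < n"
  proof -
    \<comment> \<open>\<open>A\<close> is nonempty, so \<open>v\<close> is not isolated
      itself.\<close>
    have sub: "isolated ?H \<subseteq> isolated G - A"
    proof
      fix x assume x: "x \<in> isolated ?H"
      obtain a where "a \<in> A" "a \<in> pverts G"
        using A by blast
      then have "x \<noteq> v"
        using x arcs(3)[of a a] by (auto simp: isolated_def)
      then show "x \<in> isolated G - A"
        using x arcs(1,2) by (auto simp: isolated_def)
    qed
    have fin: "finite (isolated G)"
      using pair_graph_finite[OF G] by (simp add: isolated_def)
    have le: "num_isolated ?H \<le> card (isolated G - A)"
      unfolding num_isolated_eq using sub fin by (intro card_mono) auto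
    show ?thesis
    proof (cases "2 \<le> card (isolated G)")
      case True
      then obtain i where "i \<in> isolated G"
        by fastforce
      then show ?thesis
        using twin_class_isolated[OF G] cls[of i] True le by auto
    next
      case False
      then show ?thesis
        using le card_mono[of "isolated G" "isolated G - A"] fin n by auto
    qed
  qed
  moreover have "num_isolated (complement ?H) < n"
  proof -
    let ?U = "isolated (complement G)"
    \<comment> \<open>\<open>A\<close> is not the whole vertex set, so \<open>v\<close> is not
      adjacent to every other vertex.\<close>
    have sub: "isolated (complement ?H) \<subseteq> ?U \<inter> A"
    proof
      fix x assume x: "x \<in> isolated (complement ?H)"
      obtain a where "a \<notin> A" "a \<in> pverts G"
        using A by blast
      then have "x \<noteq> v"
        using x v arcs(3)[of a a] by (auto simp: isolated_complement)
      then have xV: "x \<in> pverts G"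
        using x by (simp add: isolated_complement)
      then have "x \<in> A"
        using x v arcs(2)[of x x] \<open>x \<noteq> v\<close> by (auto simp: isolated_complement)
      moreover have "(x, u) \<in> parcs G" if "u \<in> pverts G" "u \<noteq> x" for u
        using x that xV arcs(1)[of x u] by (auto simp: isolated_complement)
      ultimately show "x \<in> ?U \<inter> A"
        using xV by (auto simp: isolated_complement)
    qed
    have fin: "finite ?U"
      using pair_graph_finite[OF G] by (simp add: isolated_def)
    have le: "num_isolated (complement ?H) \<le> card (?U \<inter> A)"
      unfolding num_isolated_eq using sub fin by (intro card_mono) auto
    show ?thesis
    proof (cases "2 \<le> card ?U")
      case True
      then obtain i where "i \<in> ?U"
        by fastforce
      then show ?thesis
        using twin_class_isolated[OF pair_graph_complement[OF G]] cls[of i] True le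
        unfolding twin_class_complement by auto
    next
      case False
      then show ?thesis
        using le card_mono[of ?U "?U \<inter> A"] fin n by auto
    qed
  qed
  ultimately show ?thesis
    using ext by blast
qed

text \<open>A graph on two vertices is edgeless or complete, so it or its complement has two
  isolated vertices.\<close>

lemma card_pverts_ge_3:
  assumes "pair_graph G" "2 \<le> card (pverts G)"
    and iso: "num_isolated G < 2" "num_isolated (complement G) < 2"
  shows "3 \<le> card (pverts G)"
proof (rule ccontr)
  assume "\<not> ?thesis"
  then have c2: "card (pverts G) = 2"
    using assms(2) by simp
  then obtain a b where ab: "pverts G = {a, b}" "a \<noteq> b"
    by (auto simp: card_2_iff)
  have "isolated G = pverts G \<or> isolated (complement G) = pverts G"
    using ab pair_graph_sym[OF assms(1), of a b] pair_graph_irrefl[OF assms(1)]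
    unfolding isolated_complement by (auto simp: isolated_def)
  then show False
    using iso c2 unfolding num_isolated_eq by auto
qed

text \<open>Each halving costs one vertex and lowers the exponent by one, until the one-vertex
  construction applies at \<open>k = 1\<close>.\<close>

lemma ex_prime_extension:
  fixes G :: "'a::infinite pair_pre_digraph"
  assumes "1 \<le> k" "pair_graph G" "2 \<le> card (pverts G)" "small_twin_modules (2 ^ k) G"
    and "num_isolated G < 2 ^ k" "num_isolated (complement G) < 2 ^ k"
  shows "\<exists>H. is_p_extension k G H \<and> prime_graph H"
  using assms
proof (induction k arbitrary: G rule: nat_induct_at_least)
  case base
  then show ?case
    using ex_prime_1_extension[of G] card_pverts_ge_3[of G] by simp
next
  case (Suc k)
  have "2 \<le> (2::nat) ^ k"
    using power_increasing[of 1 k "2::nat"] Suc.hyps by simp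
  then obtain H where H: "is_p_extension 1 G H" "small_twin_modules (2 ^ k) H"
      "num_isolated H < 2 ^ k" "num_isolated (complement H) < 2 ^ k"
    using ex_halving_1_extension[of G "2 ^ k"] Suc.prems by auto
  then have HG: "pair_graph H" "pverts G \<subseteq> pverts H"
    by (auto simp: is_p_extension_def is_extension_iff)
  then have "2 \<le> card (pverts H)"
    using card_mono[OF pair_graph_finite[OF HG(1)] HG(2)] Suc.prems(2) by simp
  then obtain K where K: "is_p_extension k H K" "prime_graph K"
    using Suc.IH[OF HG(1)] H by blast
  then show ?case
    using is_p_extension_trans[OF H(1) K(1)] by auto
qed


subsection \<open>The prime bound\<close>

text \<open>\<open>f s\<close> is the trace of \<open>s\<close> on the new vertices. Isolated
  vertices with equal traces would be twins in \<open>H\<close>, and one with empty trace would be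
  isolated in \<open>H\<close>, leaving the remaining vertices as a nontrivial module.\<close>

lemma prime_extension_lower_bound:
  assumes G: "pair_graph G" and iso: "num_isolated G = 2 ^ k"
    and ext: "is_p_extension p G H" and prime: "prime_graph H"
  shows "k < p"
proof -
  let ?X = "pverts H - pverts G"
  define f where "f s = {x \<in> ?X. (x, s) \<in> parcs H}" for s
  have H: "pair_graph H" "pverts G \<subseteq> pverts H" "parcs G = parcs H \<inter> pverts G \<times> pverts G"
    and cX: "card ?X = p"
    using ext by (auto simp: is_p_extension_def is_extension_iff)
  have fin: "finite (pverts H)"
    using pair_graph_finite[OF H(1)] .
  have H4: "4 \<le> card (pverts H)"
    and triv: "trivial_module H M" if "is_module H M" for M
    using prime that is_module_pverts[of H] by (auto simp: prime_graph_def)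
  have nbG: "(x, s) \<notin> parcs H" if "s \<in> isolated G" "x \<in> pverts G" for x s
    using that H(3) pair_graph_sym[OF H(1)] unfolding isolated_def by blast
  have inj: "inj_on f (isolated G)"
  proof (rule inj_onI, rule ccontr)
    fix s t assume st: "s \<in> isolated G" "t \<in> isolated G" "f s = f t" "s \<noteq> t"
    have "(x, s) \<in> parcs H \<longleftrightarrow> (x, t) \<in> parcs H" if x: "x \<in> pverts H" for x
      using nbG st x unfolding f_def by blast
    then have "is_module H {s, t}"
      using st H(2) by (auto simp: is_module_iff isolated_def)
    then have "trivial_module H {s, t}"
      by (rule triv)
    then have "{s, t} = pverts H"
      using st(4) by (auto simp: trivial_module_def)
    moreover have "card {s, t} = 2"
      using st(4) by simp
    ultimately show False
      using H4[OF is_module_pverts] by simp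
  qed
  have sub: "f ` isolated G \<subseteq> Pow ?X - {{}}"
  proof -
    have False if s: "s \<in> isolated G" "f s = {}" for s
    proof -
      have sH: "s \<in> pverts H"
        using s H(2) by (auto simp: isolated_def)
      have "(x, s) \<notin> parcs H" if "x \<in> pverts H" for x
        using nbG s that unfolding f_def by blast
      then have "is_module H (pverts H - {s})"
        using pair_graph_sym[OF H(1)] unfolding is_module_iff by blast
      then have "trivial_module H (pverts H - {s})"
        by (rule triv)
      moreover have "pverts H - {s} \<noteq> pverts H"
        using sH by blast
      ultimately have "pverts H - {s} = {} \<or> (\<exists>x. pverts H - {s} = {x})"
        unfolding trivial_module_def by blast
      then have "card (pverts H - {s}) \<le> 1"
        by (metis card.empty card_1_singleton_iff One_nat_def le_refl zero_le)
      then show False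
        using H4[OF is_module_pverts] sH fin by (simp add: card_Diff_singleton)
    qed
    then show ?thesis
      unfolding f_def by blast
  qed
  have "2 ^ k = card (f ` isolated G)"
    using card_image[OF inj] iso by (simp add: num_isolated_eq)
  also have "\<dots> \<le> card (Pow ?X - {{}})"
    using sub fin by (intro card_mono) auto
  \<comment> \<open>Excluding the empty trace makes this strict, which yields \<open>k < p\<close>
    instead of \<open>k \<le> p\<close>.\<close>
  also have "\<dots> < 2 ^ p"
    using fin cX by (simp add: card_Diff_singleton card_Pow)
  finally show ?thesis
    by simp
qed

lemma prime_extension_lower_bound_complement:
  assumes G: "pair_graph G" and "num_isolated (complement G) = 2 ^ k"
    and "is_p_extension p G H" and "prime_graph H"
  shows "k < p"
  using prime_extension_lower_bound[OF pair_graph_complement[OF G] assms(2)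
      is_p_extension_complement[OF G assms(3)]] assms(4)
  by (simp add: prime_graph_complement)

section \<open>The modular clique and stability numbers\<close>

lemma finite_modules: "pair_graph G \<Longrightarrow> finite {M. is_module G M \<and> Q M}"
  by (rule finite_subset[of _ "Pow (pverts G)"]) (auto dest: is_module_subset pair_graph_finite)

lemma card_module_le_modular_number:
  assumes "pair_graph G" "is_module G M"
  shows "is_clique G M \<Longrightarrow> card M \<le> modular_clique_number G"
    and "is_stable G M \<Longrightarrow> card M \<le> modular_stability_number G"
proof -
  have "finite {M. is_module G M \<and> Q M}" for Q
    using finite_modules[OF assms(1)] .
  then show "is_clique G M \<Longrightarrow> card M \<le> modular_clique_number G"
    and "is_stable G M \<Longrightarrow> card M \<le> modular_stability_number G"
    using assms(2) by (auto simp: modular_clique_number_def modular_stability_number_def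
        intro!: Max_ge)
qed

lemma modular_numbers_le_card:
  assumes "pair_graph G"
  shows "modular_clique_number G \<le> card (pverts G)"
    and "modular_stability_number G \<le> card (pverts G)"
proof -
  have fin: "finite {M. is_module G M \<and> Q M}" for Q
    using finite_modules[OF assms(1)] .
  have le: "card M \<le> card (pverts G)" if "is_module G M" for M
    using card_mono[OF pair_graph_finite[OF assms] is_module_subset[OF that]] .
  \<comment> \<open>The empty module shows that each maximum is taken over a nonempty set.\<close>
  have "is_module G {}" "is_clique G {}" "is_stable G {}"
    by (auto simp: is_module_def is_clique_def is_stable_def)
  then show "modular_clique_number G \<le> card (pverts G)"
    and "modular_stability_number G \<le> card (pverts G)"
    unfolding modular_clique_number_def modular_stability_number_def using fin le
    by (subst Max_le_iff; blast)+
qed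

theorem theorem3:
  fixes G :: "'a::infinite pair_pre_digraph" and k :: nat
  assumes "pair_graph G"
    and "k \<ge> 1"
    and "max (modular_stability_number G) (modular_clique_number G) = 2 ^ k"
  shows "prime_bound G = k + 1 \<longleftrightarrow>
    num_isolated G = 2 ^ k \<or> num_isolated (complement G) = 2 ^ k"
proof -
  note G = assms(1)
  have small: "small_twin_modules (2 ^ k) G"
    unfolding small_twin_modules_def
    using card_module_le_modular_number[OF G] assms(3) by (metis max.coboundedI1 max.coboundedI2)
  have "2 ^ 1 \<le> (2::nat) ^ k"
    using assms(2) by (intro power_increasing) auto
  then have card: "2 \<le> card (pverts G)"
    using modular_numbers_le_card[OF G] assms(3) by (simp add: max_def split: if_splits)
  have iso: "num_isolated G \<le> 2 ^ k" "num_isolated (complement G) \<le> 2 ^ k"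
    using num_isolated_le[OF G small] num_isolated_le[OF pair_graph_complement[OF G]] small
      small_twin_modules_complement[OF G] by blast+
  have small': "small_twin_modules (2 ^ (k + 1)) G"
    using small unfolding small_twin_modules_def by fastforce
  \<comment> \<open>At exponent \<open>k + 1\<close> both strict bounds on isolated vertices hold
    automatically, so \<open>k + 1\<close> new vertices always suffice.\<close>
  have ex: "\<exists>H. is_p_extension (k + 1) G H \<and> prime_graph H"
  proof (rule ex_prime_extension[OF _ G card small'])
    show "num_isolated G < 2 ^ (k + 1)" "num_isolated (complement G) < 2 ^ (k + 1)"
      using iso by (auto intro: le_less_trans)
  qed simp
  show ?thesis
  proof
    assume pb: "prime_bound G = k + 1"
    show "num_isolated G = 2 ^ k \<or> num_isolated (complement G) = 2 ^ k"
    proof (rule ccontr)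
      assume "\<not> ?thesis"
      \<comment> \<open>Both numbers are at most \<open>2 ^ k\<close>; if neither equals it, the
        construction already works at exponent \<open>k\<close>.\<close>
      then have "\<exists>H. is_p_extension k G H \<and> prime_graph H"
        using ex_prime_extension[OF assms(2) G card small] iso by simp
      then have "prime_bound G \<le> k"
        unfolding prime_bound_def by (rule Least_le)
      then show False
        using pb by simp
    qed
  next
    assume "num_isolated G = 2 ^ k \<or> num_isolated (complement G) = 2 ^ k"
    then have "k < p" if "\<exists>H. is_p_extension p G H \<and> prime_graph H" for p
      using that prime_extension_lower_bound[OF G]
        prime_extension_lower_bound_complement[OF G] by blast
    then show "prime_bound G = k + 1"
      unfolding prime_bound_def using ex by (intro Least_equality) (auto simp: Suc_le_eq)
  qed
qed

end
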